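(* Let $\alpha>0$, $\beta>\alpha/2$, and let $\gamma\in C_0(\mathbb{R}_+)$ be a positive function. Let $$\Omega:=\{z\in\mathbb{C}:\ \operatorname{Re} z>-1/(1+|\operatorname{Im} z|)^{\alpha}\}.$$ Then there exists a function $f\in C_0(\mathbb{R}_+)$ such that (a) the Laplace transform $\widehat f$ admits an analytic extension to $\Omega$ (still denoted $\widehat f$), and $$\widehat f(z)\,(1+|\operatorname{Im} z|)^{-\beta}\to 0\qquad\text{as } |z|\to\infty,\ z\in\Omega;$$ and (b) $$\limsup_{t\to\infty}\frac{t}{\gamma(t)\log t}\,\Bigl|\widehat f(0)-\int_0^t f(s)\,ds\Bigr|^{\alpha}>0.$$
   Context: $\mathbb{R}_+=[0,\infty)$ and $C_0(\mathbb{R}_+)$ is the space of continuous (scalar-valued) functions on $\mathbb{R}_+$ vanishing at infinity; functions $f$ are complex-valued. The Laplace transform of a bounded function $f$ is $\widehat f(z)=\int_0^\infty e^{-zt}f(t)\,dt$, $\operatorname{Re} z>0$. *)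

theory Defs
  imports "HOL-Complex_Analysis.Complex_Analysis"
begin

text \<open>
  Functions on \<open>[0,\<infinity>)\<close> are represented by functions on the type \<^typ>\<open>real\<close>; their values at
  negative arguments are irrelevant. The value type is \<^typ>\<open>complex\<close> or \<^typ>\<open>real\<close> below.
\<close>

definition C0_halfline :: "(real \<Rightarrow> 'a::real_normed_vector) set" where
  "C0_halfline = {f. continuous_on {0..} f \<and> (f \<longlongrightarrow> 0) at_top}"

definition laplace_transform :: "(real \<Rightarrow> complex) \<Rightarrow> complex \<Rightarrow> complex" where
  "laplace_transform f z = (LBINT t:{0..}. exp (- z * of_real t) * f t)"

definition Omega :: "real \<Rightarrow> complex set" where
  "Omega \<alpha> = {z. Re z > - 1 / (1 + \<bar>Im z\<bar>) powr \<alpha>}"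

text \<open>
  The Laplace integral is only used on \<open>Re z > 0\<close>, where it converges absolutely for bounded
  continuous \<open>f\<close>.
\<close>

definition is_laplace_extension ::
    "(real \<Rightarrow> complex) \<Rightarrow> complex set \<Rightarrow> (complex \<Rightarrow> complex) \<Rightarrow> bool" where
  "is_laplace_extension f S F \<longleftrightarrow>
     F analytic_on S \<and> {z. Re z > 0} \<subseteq> S \<and> (\<forall>z. Re z > 0 \<longrightarrow> F z = laplace_transform f z)"

end

theory Submission
  imports Defs "HOL-Real_Asymp.Real_Asymp"
begin

text \<open>
  Heuristically, a function that near time \<open>t\<close> looks like \<open>\<epsilon> e\<^bsup>\<i> R t\<^esup>\<close> makes its primitive oscillate by
  about \<open>\<epsilon> / R\<close>. Hence the \<open>\<alpha>\<close>-th power of the defect, the distance between \<open>F 0\<close> and the integral of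
  \<open>f\<close> over \<open>[0, t]\<close>, is about \<open>\<epsilon>\<^sup>\<alpha> R\<^bsup>-\<alpha>\<^esup>\<close>, which is
  \<open>\<epsilon>\<^sup>\<alpha> ln t / t\<close> if \<open>R\<^sup>\<alpha>\<close> is proportional to \<open>t / ln t\<close>. The function \<open>f\<close> is therefore built as a
  sum of wave packets with weights \<open>(1/2)\<^sup>k\<close>, the \<open>k\<close>-th peaking at a time \<open>n\<^sub>k\<close> and oscillating
  with frequency \<open>R\<^sub>k\<close>, where \<open>R\<^sub>k\<^sup>\<alpha> = A n\<^sub>k / ln n\<^sub>k\<close>, and where \<open>n\<^sub>k\<close> is so large that
  \<open>\<gamma> \<le> (1/2)\<^bsup>k \<alpha>\<^esup>\<close> from \<open>n\<^sub>k\<close> on.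

  The packets are \<open>e\<^bsup>\<i> R t\<^esup>\<close> times a normalised Gamma density \<open>(e t / n)\<^sup>n e\<^sup>-\<^sup>t\<close>, because these have
  the explicit Laplace transform \<open>b / (1 + z - \<i> R)\<^bsup>n + 1\<^esup>\<close> with \<open>b = n! (e / n)\<^sup>n = O(sqrt n)\<close>, which
  is holomorphic for \<open>Re z > -1\<close> and thus on the region. Away from the height \<open>R\<close> it is small.
  At height about \<open>R\<close> the region extends by about \<open>R\<^bsup>-\<alpha>\<^esup>\<close> into the left half-plane, and there the
  transform is at most \<open>b (1 - O(R\<^bsup>-\<alpha>\<^esup>))\<^bsup>-(n + 1)\<^esup> = O(n\<^bsup>1/2 + \<delta>\<^esup>)\<close>, where \<open>\<delta>\<close> is as small as desired if
  \<open>A\<close> is large. Since \<open>n\<close> is \<open>R\<^sup>\<alpha>\<close> up to logarithms, this is \<open>O(R\<^sup>\<beta>)\<close> because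
  \<open>\<beta> > \<alpha> / 2\<close> (\<open>eventually_packet_transform_bound\<close>). This bound, the same for all
  packets, makes the series of transforms converge locally uniformly to a holomorphic extension
  (\<open>superposition_laplace_extension\<close>), and dominated convergence gives the growth condition
  (\<open>superposition_transform_little_o\<close>).

  For the lower bound, sparse peaks make all other packets negligible near \<open>n\<^sub>k\<close>
  (\<open>superposition_near_packet\<close>), so the integral of \<open>f\<close> over the half period starting at \<open>n\<^sub>k\<close> is at
  least \<open>(1/2)\<^sup>k / (2 R\<^sub>k)\<close> (\<open>superposition_integral_ge\<close>). This integral is the difference of the
  defects at the two ends of the half period, one of which is therefore at least
  \<open>(1/2)\<^sup>k / (4 R\<^sub>k)\<close>.
\<close>

section \<open>Wave packets on the half-line\<close>

text \<open>
  The profile is the Gamma density \<open>t\<^sup>n e\<^sup>-\<^sup>t\<close>, rescaled so that its maximum, attained at \<open>t = n\<close>,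
  equals \<open>1\<close>. It lives on the half-line and has width about \<open>sqrt n\<close>, like a Gaussian, but its
  Laplace transform is an explicit power.
\<close>

definition bump :: "nat \<Rightarrow> real \<Rightarrow> real" where
  "bump n t = (exp 1 * t / n) ^ n * exp (- t)"

text \<open>
  The integral of \<open>bump n\<close> over the half-line.
\<close>

definition bump_mass :: "nat \<Rightarrow> real" where
  "bump_mass n = fact n * (exp 1 / n) ^ n"

definition packet :: "nat \<Rightarrow> real \<Rightarrow> real \<Rightarrow> complex" where
  "packet n R t = cis (R * t) * of_real (bump n t)"

definition packet_transform :: "nat \<Rightarrow> real \<Rightarrow> complex \<Rightarrow> complex" where
  "packet_transform n R z = of_real (bump_mass n) / (1 + z - \<i> * of_real R) ^ Suc n"

text \<open>
  The inequality \<open>x \<le> e\<^bsup>x - 1\<^esup>\<close>, raised to the power \<open>n\<close> at \<open>x = u / n\<close>. With \<open>u = t\<close> it bounds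
  \<open>bump n t\<close> by \<open>1\<close>; with smaller multiples of \<open>t\<close> it leaves exponential decay to spare.
\<close>

lemma scaled_power_le_exp:
  assumes "n > 0" "u \<ge> 0"
  shows "(exp 1 * u / real n) ^ n \<le> exp u"
proof -
  have "u / n \<le> exp (u / n - 1)"
    using exp_ge_add_one_self[of "u / n - 1"] by simp
  then have "exp 1 * u / n \<le> exp (u / n)"
    by (simp add: exp_diff field_simps)
  then have "(exp 1 * u / n) ^ n \<le> exp (u / n) ^ n"
    using assms by (intro power_mono) auto
  also have "\<dots> = exp u"
    using assms by (simp flip: exp_of_nat_mult)
  finally show ?thesis .
qed

lemma bump_nonneg: "t \<ge> 0 \<Longrightarrow> 0 \<le> bump n t"
  by (simp add: bump_def)

lemma bump_le_1:
  assumes "n > 0" "t \<ge> 0"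
  shows "bump n t \<le> 1"
  using mult_right_mono[OF scaled_power_le_exp[OF assms], of "exp (- t)"]
  by (simp add: bump_def flip: exp_add)

lemma bump_le_exp_decay:
  assumes "n > 0" "t \<ge> 0"
  shows "bump n t \<le> 2 ^ n * exp (- t / 2)"
proof -
  have "bump n t = 2 ^ n * (exp 1 * (t / 2) / n) ^ n * exp (- t)"
    by (simp add: bump_def flip: power_mult_distrib)
  also have "\<dots> \<le> 2 ^ n * exp (t / 2) * exp (- t)"
    using scaled_power_le_exp[of n "t / 2"] assms by (intro mult_right_mono mult_left_mono) auto
  also have "\<dots> = 2 ^ n * exp (- t / 2)"
    by (simp add: mult.assoc flip: exp_add)
  finally show ?thesis .
qed

text \<open>
  Well before the peak the base \<open>e t / n\<close> of the power is already below \<open>1 / 2\<close>.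
\<close>

lemma bump_le_before_peak:
  assumes "n > 0" "t \<ge> 0" "8 * t \<le> real n"
  shows "bump n t \<le> (1 / 2) ^ n"
proof -
  have "exp 1 * t / n \<le> 3 * (1 / 8)"
    using exp_le assms mult_mono[of "exp 1" 3 "t / n" "1 / 8"] by simp
  then have "exp 1 * t / n \<le> 1 / 2" by linarith
  then have "(exp 1 * t / n) ^ n \<le> (1 / 2) ^ n"
    using assms by (intro power_mono) (auto simp del: mult_le_cancel_left divide_le_eq_1_pos)
  then have "bump n t \<le> (1 / 2) ^ n * exp 0"
    unfolding bump_def using assms by (intro mult_mono) auto
  then show ?thesis by simp
qed

text \<open>
  With \<open>t = n + u\<close> the profile is \<open>(1 + u / n)\<^sup>n e\<^sup>-\<^sup>u \<ge> (1 + u) (1 - u)\<close>, by Bernoulli's inequality.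
\<close>

lemma bump_ge_near_peak:
  assumes "n > 0" "real n \<le> t" "t \<le> n + 1 / 2"
  shows "1 / 2 \<le> bump n t"
proof -
  define u where "u = t - n"
  have u: "0 \<le> u" "u \<le> 1 / 2" using assms by (auto simp: u_def)
  have t: "t = n + u" by (simp add: u_def)
  have e: "bump n t = (1 + u / n) ^ n * exp (- u)"
  proof -
    have "exp 1 * t / n = exp 1 * (1 + u / n)"
      using assms by (simp add: t field_simps)
    then have "bump n t = exp 1 ^ n * (1 + u / n) ^ n * exp (- (n + u))"
      by (simp add: bump_def power_mult_distrib t)
    also have "exp (1::real) ^ n = exp n"
      by (simp flip: exp_of_nat_mult)
    finally show ?thesis
      by (simp add: exp_diff exp_minus field_simps)
  qed
  have "1 + n * (u / n) \<le> (1 + u / n) ^ n"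
    using u by (intro Bernoulli_inequality) (auto intro: order_trans[of "-1" 0])
  then have "1 + u \<le> (1 + u / n) ^ n" using assms by simp
  moreover have "1 - u \<le> exp (- u)"
    using exp_ge_add_one_self[of "- u"] by simp
  ultimately have "(1 + u) * (1 - u) \<le> bump n t"
    unfolding e using u by (intro mult_mono) auto
  moreover have "(1 + u) * (1 - u) \<ge> 1 / 2"
    using mult_mono[of u "1/2" u "1/2"] u by (simp add: algebra_simps)
  ultimately show ?thesis by linarith
qed

text \<open>
  The upper half of Stirling's formula. Here the exponent \<open>1/2\<close> is exactly what the hypothesis
  \<open>\<beta> > \<alpha> / 2\<close> has to pay for. The quotient of consecutive masses is controlled by
  \<open>ln (1 + 1 / n) \<ge> 2 / (2 n + 1)\<close>.
\<close>

lemma bump_mass_le: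
  assumes "n > 0"
  shows "bump_mass n \<le> exp 1 * sqrt n"
  using assms
proof (induction n rule: nat_induct_non_zero)
  case 1
  then show ?case by (simp add: bump_mass_def)
next
  case (Suc n)
  let ?x = "real n"
  have x: "?x > 0" using Suc by simp
  have "2 / (2 * ?x + 1) \<le> ln (?x + 1) - ln ?x"
    using ln_inverse_approx_ge[of ?x "?x + 1"] x by (simp add: add_ac)
  then have "1 \<le> (?x + 1 / 2) * (ln (?x + 1) - ln ?x)"
    using x by (simp add: field_simps)
  then have "1 - n * (ln (?x + 1) - ln ?x) \<le> (ln (?x + 1) - ln ?x) / 2"
    by (simp add: algebra_simps)
  then have "exp (1 - n * (ln (?x + 1) - ln ?x)) \<le> exp ((ln (?x + 1) - ln ?x) / 2)"
    by simp
  moreover have "exp (1 - n * (ln (?x + 1) - ln ?x)) = exp 1 * (?x / (?x + 1)) ^ n"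
    using x by (simp add: exp_diff exp_of_nat_mult power_divide)
  moreover have "exp ((ln (?x + 1) - ln ?x) / 2) = sqrt (?x + 1) / sqrt ?x"
    using x by (simp add: ln_sqrt[symmetric] diff_divide_distrib exp_diff)
  ultimately have step: "exp 1 * (?x / (?x + 1)) ^ n \<le> sqrt (?x + 1) / sqrt ?x"
    by simp
  have "bump_mass (Suc n) = bump_mass n * (exp 1 * (?x / (?x + 1)) ^ n)"
  proof -
    have "(?x + 1) ^ Suc n \<noteq> 0" "?x ^ n \<noteq> 0" using x by auto
    then show ?thesis
      by (simp add: bump_mass_def power_divide divide_simps add.commute del: power_Suc)
         (simp add: algebra_simps)
  qed
  also have "\<dots> \<le> (exp 1 * sqrt n) * (sqrt (?x + 1) / sqrt ?x)"
    using Suc step by (intro mult_mono) (auto simp: bump_mass_def)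
  also have "\<dots> = exp 1 * sqrt (Suc n)"
    using x by (simp add: add.commute)
  finally show ?case .
qed

lemma set_integrable_exp_decay:
  assumes "a > (0::real)"
  shows "set_integrable lborel {0..} (\<lambda>t. exp (- a * t))"
proof -
  have "(\<lambda>t. exp (- a * t)) absolutely_integrable_on {0..}"
    using assms by (intro nonnegative_absolutely_integrable_1 integrable_on_exp_minus_to_infinity) auto
  then show ?thesis
    unfolding set_integrable_def
    by (subst (asm) integrable_completion) (auto intro!: borel_measurable_continuous_on_indicator continuous_intros)
qed

section \<open>The Laplace transform of a packet\<close>

lemma norm_power_exp_le:
  assumes "Re w > 0"
  obtains C where "\<And>t::real. t \<ge> 0 \<Longrightarrow> norm (of_real t ^ n * exp (- w * of_real t)) \<le> C * exp (- (Re w / 2) * t)"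
proof -
  obtain C where C: "\<And>t::real. t \<ge> 0 \<Longrightarrow> t ^ n \<le> C * exp (Re w / 2 * t)"
  proof (cases "n = 0")
    case True
    with assms show ?thesis by (intro that[of 1]) auto
  next
    case False
    show ?thesis
    proof (rule that)
      fix t :: real assume "t \<ge> 0"
      then have "t ^ n = (2 * n / (exp 1 * Re w)) ^ n * (exp 1 * (Re w / 2 * t) / n) ^ n"
        using False assms by (simp flip: power_mult_distrib)
      also have "\<dots> \<le> (2 * n / (exp 1 * Re w)) ^ n * exp (Re w / 2 * t)"
        using scaled_power_le_exp[of n "Re w / 2 * t"] False assms \<open>t \<ge> 0\<close>
        by (intro mult_left_mono) auto
      finally show "t ^ n \<le> (2 * n / (exp 1 * Re w)) ^ n * exp (Re w / 2 * t)" .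
    qed
  qed
  show ?thesis
  proof (rule that)
    fix t :: real assume "t \<ge> 0"
    then have "norm (of_real t ^ n * exp (- w * of_real t)) = t ^ n * exp (- Re w * t)"
      by (simp add: norm_mult norm_power)
    also have "\<dots> \<le> C * exp (Re w / 2 * t) * exp (- Re w * t)"
      using C \<open>t \<ge> 0\<close> by (intro mult_right_mono) auto
    also have "\<dots> = C * exp (- (Re w / 2) * t)"
      by (simp add: mult.assoc flip: exp_add)
    finally show "norm (of_real t ^ n * exp (- w * of_real t)) \<le> C * exp (- (Re w / 2) * t)" .
  qed
qed

lemma set_integrable_power_exp:
  assumes "Re w > 0"
  shows "set_integrable lborel {0..} (\<lambda>t. complex_of_real t ^ n * exp (- w * of_real t))"
proof -
  obtain C where C: "\<And>t::real. t \<ge> 0 \<Longrightarrow>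
      norm (of_real t ^ n * exp (- w * of_real t)) \<le> C * exp (- (Re w / 2) * t)"
    using norm_power_exp_le[OF assms] by blast
  show ?thesis
  proof (rule set_integrable_bound)
    show "set_integrable lborel {0..} (\<lambda>t. C * exp (- (Re w / 2) * t))"
      using assms by (intro set_integrable_mult_right set_integrable_exp_decay) auto
    show "set_borel_measurable lborel {0..} (\<lambda>t. complex_of_real t ^ n * exp (- w * of_real t))"
      unfolding set_borel_measurable_def
      by (auto intro!: borel_measurable_continuous_on_indicator continuous_intros)
    show "AE t in lborel. t \<in> {0..} \<longrightarrow>
        norm (complex_of_real t ^ n * exp (- w * of_real t)) \<le> norm (C * exp (- (Re w / 2) * t))"
      using order_trans[OF C abs_ge_self] by (intro AE_I2) simp
  qed
qed

text \<open>
  Induction on \<open>n\<close>: integrating the derivative of \<open>t\<^sup>n e\<^bsup>-wt\<^esup>\<close> over the half-line relates the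
  integrals for \<open>n - 1\<close> and \<open>n\<close>.
\<close>

lemma laplace_power:
  assumes "Re w > 0"
  shows "(LBINT t:{0..}. complex_of_real t ^ n * exp (- w * of_real t)) = fact n / w ^ Suc n"
proof -
  have w: "w \<noteq> 0" using assms by auto
  define g where "g n t = complex_of_real t ^ n * exp (- w * of_real t)" for n t
  have int: "set_integrable lborel {0..} (g n)" for n
    using set_integrable_power_exp[OF assms] by (simp add: g_def[abs_def])
  have lim: "(g n \<longlongrightarrow> 0) at_top" for n
  proof -
    obtain C where C: "\<And>t::real. t \<ge> 0 \<Longrightarrow> norm (g n t) \<le> C * exp (- (Re w / 2) * t)"
      using norm_power_exp_le[OF assms] unfolding g_def by blast
    have "((\<lambda>t. C * exp (- (Re w / 2) * t)) \<longlongrightarrow> 0) at_top"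
      using assms by real_asymp
    then show ?thesis
      by (rule Lim_null_comparison[rotated]) (rule eventually_mono[OF eventually_ge_at_top[of 0] C])
  qed
  \<comment> \<open>The boundary term \<open>0 ^ n\<close> is \<open>1\<close> for \<open>n = 0\<close> and vanishes otherwise, so this one identity
    serves both the base case and the step.\<close>
  have rec: "n * (LBINT t:{0..}. g (n - 1) t) - w * (LBINT t:{0..}. g n t) = - (0 ^ n)" for n
  proof -
    let ?d = "\<lambda>t. n * g (n - 1) t - w * g n t"
    have "set_integrable lborel {0..} ?d"
      by (intro set_integral_diff set_integrable_mult_right int)
    then have lim_int: "((\<lambda>b. set_lebesgue_integral lborel {0..b} ?d)
        \<longlongrightarrow> set_lebesgue_integral lborel {0..} ?d) at_top"
      by (intro tendsto_set_lebesgue_integral_at_top) auto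
    have deriv: "(g n has_vector_derivative ?d t) (at t within A)" for t A
      unfolding g_def
      by (rule has_vector_derivative_real_field)
         (auto intro!: derivative_eq_intros simp: algebra_simps)
    have cont: "continuous_on A ?d" for A
      unfolding g_def by (intro continuous_intros)
    have "g n b - g n 0 = set_lebesgue_integral lborel {0..b} ?d" if "b \<ge> 0" for b
      unfolding set_lebesgue_integral_def using that deriv cont
      by (intro integral_FTC_atLeastAtMost[symmetric])
    then have ev: "\<forall>\<^sub>F b in at_top. g n b - g n 0 = set_lebesgue_integral lborel {0..b} ?d"
      by (rule eventually_mono[OF eventually_ge_at_top[of 0]])
    have "((\<lambda>b. g n b - g n 0) \<longlongrightarrow> 0 - g n 0) at_top"
      by (intro tendsto_intros lim)
    from Lim_transform_eventually[OF this ev] lim_int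
    have "set_lebesgue_integral lborel {0..} ?d = 0 - g n 0"
      by (intro tendsto_unique[OF trivial_limit_at_top_linorder])
    also have "set_lebesgue_integral lborel {0..} ?d
        = n * (LBINT t:{0..}. g (n - 1) t) - w * (LBINT t:{0..}. g n t)"
      by (subst set_integral_diff) (auto intro!: int)
    finally show ?thesis by (simp add: g_def)
  qed
  have "(LBINT t:{0..}. g n t) = fact n / w ^ Suc n"
  proof (induction n)
    case 0
    from rec[of 0] show ?case using w by (simp add: field_simps)
  next
    case (Suc n)
    from rec[of "Suc n"] have "w * (LBINT t:{0..}. g (Suc n) t) = Suc n * (LBINT t:{0..}. g n t)"
      by simp
    then show ?case using w unfolding Suc by (simp add: field_simps)
  qed
  then show ?thesis by (simp add: g_def)
qed

text \<open>
  The pole \<open>-1 + \<i> R\<close> of the transform lies on the line \<open>Re z = -1\<close>, which \<open>Omega \<alpha>\<close> does not meet.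
\<close>

lemma packet_laplace:
  assumes "Re z > -1"
  shows "set_integrable lborel {0..} (\<lambda>t. exp (- z * of_real t) * packet n R t)"
    and "(LBINT t:{0..}. exp (- z * of_real t) * packet n R t) = packet_transform n R z"
proof -
  define w where "w = 1 + z - \<i> * of_real R"
  have w: "Re w > 0" using assms by (simp add: w_def)
  have e: "exp (- z * of_real t) * packet n R t
      = of_real ((exp 1 / n) ^ n) * (of_real t ^ n * exp (- w * of_real t))" for t :: real
  proof -
    have "exp (- w * of_real t) = exp (- z * of_real t) * cis (R * t) * of_real (exp (- t))"
      by (simp add: w_def cis_conv_exp algebra_simps flip: exp_of_real exp_add)
    then show ?thesis
      by (simp add: packet_def bump_def power_mult_distrib power_divide)
  qed
  show "set_integrable lborel {0..} (\<lambda>t. exp (- z * of_real t) * packet n R t)"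
    unfolding e by (intro set_integrable_mult_right set_integrable_power_exp w)
  show "(LBINT t:{0..}. exp (- z * of_real t) * packet n R t) = packet_transform n R z"
    unfolding e using laplace_power[OF w, of n]
    by (simp add: packet_transform_def bump_mass_def w_def)
qed

section \<open>The size of the transforms on the region\<close>

text \<open>
  The frequency \<open>R\<close> given to the packet peaking at time \<open>n\<close>: it solves \<open>n = R\<^sup>\<alpha> ln n / A\<close>. At
  height \<open>R\<close> the region reaches about \<open>R\<^bsup>-\<alpha>\<^esup>\<close> to the left of the imaginary axis, so the transform
  grows there by a factor \<open>exp (n R\<^bsup>-\<alpha>\<^esup>)\<close>, which is a power of \<open>n\<close> with exponent proportional to
  \<open>1 / A\<close>.
\<close>

definition freq :: "real \<Rightarrow> real \<Rightarrow> nat \<Rightarrow> real" where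
  "freq A \<alpha> n = (A * n / ln n) powr (1 / \<alpha>)"

text \<open>
  Far from the height \<open>R\<close> the denominator \<open>\<bar>1 + z - \<i> R\<bar>\<^bsup>n + 1\<^esup>\<close> is at least \<open>2\<^bsup>n + 1\<^esup>\<close> and absorbs the
  mass of the packet. At heights comparable to \<open>R\<close> or above, \<open>Re z > - x\<close> with
  \<open>x = \<delta> ln n / (4 n)\<close>, so the transform is at most
  \<open>bump_mass n * (1 - x)\<^bsup>-(n + 1)\<^esup> \<le> bump_mass n * n\<^sup>\<delta>\<close>, and there \<open>(1 + \<bar>Im z\<bar>)\<^sup>\<beta>\<close> is at least
  \<open>(R / 2)\<^sup>\<beta>\<close>.
\<close>

lemma packet_transform_bound:
  assumes "\<alpha> > 0" "\<beta> \<ge> 0" "\<delta> > 0" "n > 1"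
    and R: "R powr \<alpha> = 2 powr \<alpha> * 4 / \<delta> * n / ln n" "R \<ge> 4"
    and small: "\<delta> * ln n / (4 * n) \<le> 1 / 2"
    and mass: "bump_mass n \<le> 2 ^ Suc n" "bump_mass n * n powr \<delta> \<le> (R / 2) powr \<beta>"
    and z: "z \<in> Omega \<alpha>"
  shows "norm (packet_transform n R z) \<le> (1 + \<bar>Im z\<bar>) powr \<beta>"
proof -
  have b: "bump_mass n \<ge> 0" by (simp add: bump_mass_def)
  have norm_eq: "norm (packet_transform n R z) = bump_mass n / norm (1 + z - \<i> * of_real R) ^ Suc n"
    using b by (simp add: packet_transform_def norm_divide norm_power norm_mult)
  show ?thesis
  proof (cases "\<bar>Im z\<bar> \<le> R / 2")
    case True
    then have "2 \<le> \<bar>Im (1 + z - \<i> * of_real R)\<bar>"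
      using R by auto
    also have "\<dots> \<le> norm (1 + z - \<i> * of_real R)"
      by (rule abs_Im_le_cmod)
    finally have "2 ^ Suc n \<le> norm (1 + z - \<i> * of_real R) ^ Suc n"
      by (intro power_mono) auto
    then have "norm (packet_transform n R z) \<le> 2 ^ Suc n / 2 ^ Suc n"
      unfolding norm_eq using b mass by (intro frac_le) auto
    also have "\<dots> \<le> (1 + \<bar>Im z\<bar>) powr \<beta>"
      using \<open>\<beta> \<ge> 0\<close> by (simp add: ge_one_powr_ge_zero)
    finally show ?thesis .
  next
    case False
    define x where "x = \<delta> * ln n / (4 * n)"
    have x: "0 \<le> x" "x \<le> 1 / 2"
      using small assms by (auto simp: x_def)
    have "(R / 2) powr \<alpha> \<le> (1 + \<bar>Im z\<bar>) powr \<alpha>"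
      using False R \<open>\<alpha> > 0\<close> by (intro powr_mono2) auto
    then have "1 / (1 + \<bar>Im z\<bar>) powr \<alpha> \<le> 1 / (R / 2) powr \<alpha>"
      using R by (intro divide_left_mono) auto
    also have "1 / (R / 2) powr \<alpha> = x"
      using R assms(3,4) by (simp add: powr_divide x_def field_simps)
    finally have "1 - x \<le> Re (1 + z - \<i> * of_real R)"
      using z by (simp add: Omega_def)
    also have "\<dots> \<le> norm (1 + z - \<i> * of_real R)"
      by (rule complex_Re_le_cmod)
    finally have *: "1 - x \<le> norm (1 + z - \<i> * of_real R)" .
    have "- x - 2 * x\<^sup>2 \<le> ln (1 - x)"
      using x by (intro ln_one_minus_pos_lower_bound)
    moreover have "2 * x\<^sup>2 \<le> x"
      using x mult_left_mono[of x "1/2" x] by (simp add: power2_eq_square)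
    ultimately have "- 2 * x \<le> ln (1 - x)" by simp
    then have "exp (- 2 * x) \<le> 1 - x"
      using x by (subst (asm) ln_ge_iff) auto
    with * have "exp (- 2 * x) ^ Suc n \<le> norm (1 + z - \<i> * of_real R) ^ Suc n"
      by (intro power_mono) auto
    moreover have "exp (- 2 * x) ^ Suc n \<ge> n powr (- \<delta>)"
    proof -
      have "Suc n * (2 * x) \<le> (2 * n) * (2 * x)"
        using x assms by (intro mult_right_mono) auto
      also have "\<dots> = \<delta> * ln n"
        using assms by (simp add: x_def)
      finally have "- (\<delta> * ln n) \<le> Suc n * (- 2 * x)" by simp
      moreover have "exp (- 2 * x) ^ Suc n = exp (Suc n * (- 2 * x))"
        by (rule exp_of_nat_mult[symmetric])
      moreover have "n powr (- \<delta>) = exp (- (\<delta> * ln n))"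
        using assms by (simp add: powr_def)
      ultimately show ?thesis by (simp del: power_Suc of_nat_Suc)
    qed
    ultimately have "n powr (- \<delta>) \<le> norm (1 + z - \<i> * of_real R) ^ Suc n"
      by (rule order_trans[rotated])
    then have "norm (packet_transform n R z) \<le> bump_mass n / n powr (- \<delta>)"
      unfolding norm_eq using b assms(4) by (intro frac_le) auto
    also have "\<dots> = bump_mass n * n powr \<delta>"
      by (simp add: powr_minus field_simps)
    also have "\<dots> \<le> (R / 2) powr \<beta>" by fact
    also have "\<dots> \<le> (1 + \<bar>Im z\<bar>) powr \<beta>"
      using False R assms by (intro powr_mono2) auto
    finally show ?thesis .
  qed
qed

text \<open>
  As \<open>R\<^sup>\<beta>\<close> is \<open>n\<^bsup>\<beta>/\<alpha>\<^esup>\<close> up to logarithms and \<open>\<beta> / \<alpha> > 1 / 2\<close>, there is room for the factor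
  \<open>n\<^bsup>1/2 + \<delta>\<^esup>\<close> as soon as \<open>1 / 2 + \<delta> < \<beta> / \<alpha>\<close>; the choice of \<open>\<delta>\<close> takes half of the
  available gap, and the other half beats the logarithms.
\<close>

lemma eventually_packet_transform_bound:
  assumes "\<alpha> > 0" "\<beta> > \<alpha> / 2"
  obtains A where "A > 0"
    "\<forall>\<^sub>F n in sequentially. freq A \<alpha> n \<ge> 8 \<and>
      (\<forall>z\<in>Omega \<alpha>. norm (packet_transform n (freq A \<alpha> n) z) \<le> (1 + \<bar>Im z\<bar>) powr \<beta>)"
proof -
  define \<delta> where "\<delta> = (\<beta> / \<alpha> - 1 / 2) / 2"
  have \<delta>: "\<delta> > 0" using assms by (simp add: \<delta>_def field_simps)
  have \<beta>: "\<beta> / \<alpha> = 1 / 2 + 2 * \<delta>" using assms by (simp add: \<delta>_def field_simps)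
  define A where "A = 2 powr \<alpha> * 4 / \<delta>"
  have A: "A > 0" using \<delta> by (simp add: A_def)
  have "\<forall>\<^sub>F n in sequentially. (A * real n / ln (real n)) powr (1 / \<alpha>) \<ge> 8"
    using A assms by real_asymp
  then have 1: "\<forall>\<^sub>F n in sequentially. freq A \<alpha> n \<ge> 8"
    by (simp add: freq_def)
  have 2: "\<forall>\<^sub>F n in sequentially. \<delta> * ln (real n) / (4 * real n) \<le> 1 / 2"
    using \<delta> by real_asymp
  have 3: "\<forall>\<^sub>F n in sequentially. exp 1 * sqrt (real n) \<le> 2 ^ Suc n"
    by real_asymp
  define c where "c = exp 1 * 2 powr \<beta> / A powr (\<beta> / \<alpha>)"
  have "\<forall>\<^sub>F n in sequentially. c * real n powr (- \<delta>) * ln (real n) powr (\<beta> / \<alpha>) \<le> 1"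
    using \<delta> by real_asymp
  then have 4: "\<forall>\<^sub>F n in sequentially. exp 1 * sqrt (real n) * real n powr \<delta> \<le> (freq A \<alpha> n / 2) powr \<beta>"
    using eventually_gt_at_top[of 1]
  proof eventually_elim
    case (elim n)
    have ln: "ln (real n) > 0" using elim by simp
    have "(freq A \<alpha> n / 2) powr \<beta> = (A * n / ln n) powr (\<beta> / \<alpha>) / 2 powr \<beta>"
      using elim A by (simp add: freq_def powr_divide powr_mult powr_powr)
    also have "\<dots> = A powr (\<beta> / \<alpha>) * n powr (\<beta> / \<alpha>) / ln n powr (\<beta> / \<alpha>) / 2 powr \<beta>"
      using A ln by (simp add: powr_divide powr_mult)
    also have "n powr (\<beta> / \<alpha>) = sqrt n * n powr \<delta> * n powr \<delta>"
      unfolding \<beta> mult_2 powr_add using elim by (simp add: powr_half_sqrt)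
    finally have "(freq A \<alpha> n / 2) powr \<beta> = A powr (\<beta> / \<alpha>) * (sqrt n * n powr \<delta> * n powr \<delta>) / ln n powr (\<beta> / \<alpha>) / 2 powr \<beta>" .
    then have "exp 1 * sqrt n * n powr \<delta> = (c * n powr (- \<delta>) * ln n powr (\<beta> / \<alpha>)) * (freq A \<alpha> n / 2) powr \<beta>"
      using A ln elim by (simp add: c_def powr_minus field_simps)
    also have "\<dots> \<le> 1 * (freq A \<alpha> n / 2) powr \<beta>"
      using elim by (intro mult_right_mono) auto
    finally show ?case by simp
  qed
  from 1 2 3 4 eventually_gt_at_top[of 1] 
  have "\<forall>\<^sub>F n in sequentially. freq A \<alpha> n \<ge> 8 \<and>
      (\<forall>z\<in>Omega \<alpha>. norm (packet_transform n (freq A \<alpha> n) z) \<le> (1 + \<bar>Im z\<bar>) powr \<beta>)"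
  proof eventually_elim
    case (elim n)
    have "bump_mass n \<le> exp 1 * sqrt n"
      using elim by (intro bump_mass_le) auto
    moreover from this have "bump_mass n * n powr \<delta> \<le> exp 1 * sqrt n * n powr \<delta>"
      by (intro mult_right_mono) auto
    with elim have "bump_mass n * n powr \<delta> \<le> (freq A \<alpha> n / 2) powr \<beta>"
      by linarith
    moreover have "freq A \<alpha> n powr \<alpha> = A * n / ln n"
      using elim A assms by (simp add: freq_def powr_powr)
    then have "freq A \<alpha> n powr \<alpha> = 2 powr \<alpha> * 4 / \<delta> * n / ln n"
      by (simp add: A_def)
    ultimately show ?case
      using elim assms \<delta> by (auto intro!: packet_transform_bound[where \<delta> = \<delta>] simp del: mult_le_cancel_right)
  qed
  with A show ?thesis by (rule that)
qed

section \<open>Superpositions of packets\<close>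

text \<open>
  The weights are kept fixed and summable. Smallness relative to \<open>\<gamma>\<close> comes from placing the
  \<open>k\<close>-th packet so late that \<open>\<gamma>\<close> has dropped below the \<open>\<alpha>\<close>-th power of its weight.
\<close>

definition superposition :: "(nat \<Rightarrow> nat) \<Rightarrow> (nat \<Rightarrow> real) \<Rightarrow> real \<Rightarrow> complex" where
  "superposition n R t = (\<Sum>k. (1 / 2) ^ k * packet (n k) (R k) t)"

definition superposition_transform :: "(nat \<Rightarrow> nat) \<Rightarrow> (nat \<Rightarrow> real) \<Rightarrow> complex \<Rightarrow> complex" where
  "superposition_transform n R z = (\<Sum>k. (1 / 2) ^ k * packet_transform (n k) (R k) z)"

lemma norm_packet: "t \<ge> 0 \<Longrightarrow> norm (packet n R t) = bump n t"
  by (simp add: packet_def norm_mult bump_nonneg)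

lemma continuous_on_packet: "continuous_on A (packet n R)"
  unfolding packet_def bump_def divide_inverse by (intro continuous_intros)

lemma norm_packet_term_le:
  assumes "n > 0" "t \<ge> 0"
  shows "norm ((1 / 2) ^ k * packet n R t) \<le> (1 / 2) ^ k"
  using mult_left_mono[OF bump_le_1[OF assms], of "(1 / 2) ^ k"] assms
  by (simp add: norm_mult norm_power norm_divide norm_packet)

lemma summable_half: "summable (\<lambda>k. (1 / 2 :: real) ^ k)"
  by (simp add: summable_geometric)

text \<open>
  Dominated convergence for series.
\<close>

lemma tendsto_suminf_0:
  fixes a :: "nat \<Rightarrow> 'b \<Rightarrow> complex"
  assumes lim: "\<And>k. (a k \<longlongrightarrow> 0) F"
    and bound: "\<forall>\<^sub>F x in F. \<forall>k. norm (a k x) \<le> M k" and "summable M"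
  shows "((\<lambda>x. \<Sum>k. a k x) \<longlongrightarrow> 0) F"
proof (cases "F = bot")
  case False
  have "\<forall>\<^sub>F (k, x) in at_top \<times>\<^sub>F F. norm (a k x) \<le> M k"
    using eventually_prodI[OF eventually_True[of at_top] bound]
    by (rule eventually_mono) auto
  from tannerys_theorem[OF lim this \<open>summable M\<close> False] show ?thesis by simp
qed simp

lemma superposition_in_C0:
  assumes "\<And>k. n k > 0"
  shows "superposition n R \<in> C0_halfline"
proof -
  have "uniform_limit {0..} (\<lambda>N t. \<Sum>k<N. (1 / 2) ^ k * packet (n k) (R k) t)
      (superposition n R) sequentially"
    unfolding superposition_def
    by (rule Weierstrass_m_test[OF _ summable_half]) (use norm_packet_term_le assms in auto)
  then have "continuous_on {0..} (superposition n R)"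
    by (rule uniform_limit_theorem[rotated])
       (auto intro!: always_eventually continuous_intros continuous_on_packet)
  moreover have "(superposition n R \<longlongrightarrow> 0) at_top"
    unfolding superposition_def
  proof (rule tendsto_suminf_0[OF _ _ summable_half])
    fix k
    have "(packet (n k) (R k) \<longlongrightarrow> 0) at_top"
    proof (rule Lim_null_comparison)
      show "\<forall>\<^sub>F t in at_top. norm (packet (n k) (R k) t) \<le> 2 ^ n k * exp (- t / 2)"
        using eventually_ge_at_top[of 0]
        by eventually_elim (use bump_le_exp_decay assms in \<open>simp add: norm_packet\<close>)
      show "((\<lambda>t::real. 2 ^ n k * exp (- t / 2)) \<longlongrightarrow> 0) at_top"
        by real_asymp
    qed
    then show "((\<lambda>t. (1 / 2) ^ k * packet (n k) (R k) t) \<longlongrightarrow> 0) at_top"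
      by (rule tendsto_mult_right_zero)
  next
    show "\<forall>\<^sub>F t in at_top. \<forall>k. norm ((1 / 2) ^ k * packet (n k) (R k) t) \<le> (1 / 2) ^ k"
      using eventually_ge_at_top[of 0]
      by eventually_elim (use norm_packet_term_le assms in blast)
  qed
  ultimately show ?thesis by (simp add: C0_halfline_def)
qed

text \<open>
  For \<open>Re z > 0\<close> the packets are bounded by \<open>1\<close>, so the integrals of the absolute values of the
  terms are at most \<open>(1/2)\<^sup>k / Re z\<close>, and sum and integral may be interchanged.
\<close>

lemma laplace_superposition:
  assumes n: "\<And>k. n k > 0" and z: "Re z > 0"
  shows "laplace_transform (superposition n R) z = superposition_transform n R z"
proof -
  define f where "f k t = indicator {0..} t *\<^sub>R (exp (- z * of_real t) * ((1 / 2) ^ k * packet (n k) (R k) t))" for k and t :: real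
  have f_alt: "f k t = (1 / 2) ^ k * (indicator {0..} t *\<^sub>R (exp (- z * of_real t) * packet (n k) (R k) t))" for k t
    by (simp add: f_def)
  have pkt: "integrable lborel (\<lambda>t. indicator {0..} t *\<^sub>R (exp (- z * of_real t) * packet (n k) (R k) t))" for k
    using packet_laplace(1)[of z "n k" "R k"] z by (simp add: set_integrable_def)
  have int: "integrable lborel (f k)" for k
    unfolding f_alt by (intro integrable_mult_right pkt)
  have bound: "norm (f k t) \<le> (1 / 2) ^ k * (indicator {0..} t *\<^sub>R exp (- Re z * t))" for k t
  proof (cases "t \<ge> 0")
    case True
    then show ?thesis
      using mult_right_mono[OF norm_packet_term_le[OF n[of k] True, of k "R k"], of "exp (- Re z * t)"]
      by (simp add: f_def norm_mult mult.commute)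
  qed (simp add: f_def)
  have int_exp: "integrable lborel (\<lambda>t. (1 / 2) ^ k * (indicator {0..} t *\<^sub>R exp (- Re z * t)))" for k :: nat
    using set_integrable_exp_decay[OF z] by (intro integrable_mult_right) (simp add: set_integrable_def)
  have "(\<lambda>k. integral\<^sup>L lborel (f k)) sums (\<integral>t. (\<Sum>k. f k t) \<partial>lborel)"
  proof (rule sums_integral[OF int])
    have "summable (\<lambda>k. norm (f k t))" for t
      by (rule summable_comparison_test'[OF summable_mult2[OF summable_half], of 0])
         (use bound in simp)
    then show "AE t in lborel. summable (\<lambda>k. norm (f k t))" by simp
    show "summable (\<lambda>k. \<integral>t. norm (f k t) \<partial>lborel)"
    proof (rule summable_comparison_test'[OF summable_mult2[OF summable_half], of 0])
      fix k
      have "(\<integral>t. norm (f k t) \<partial>lborel) \<le> (\<integral>t. (1 / 2) ^ k * (indicator {0..} t *\<^sub>R exp (- Re z * t)) \<partial>lborel)"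
        by (intro integral_mono int_exp integrable_norm int bound)
      then show "norm (\<integral>t. norm (f k t) \<partial>lborel) \<le> (1 / 2) ^ k * (\<integral>t. indicator {0..} t *\<^sub>R exp (- Re z * t) \<partial>lborel)"
        by simp
    qed
  qed
  moreover have "integral\<^sup>L lborel (f k) = (1 / 2) ^ k * packet_transform (n k) (R k) z" for k
    unfolding f_alt using packet_laplace(2)[of z "n k" "R k"] z
    by (subst integral_mult_right_zero) (simp add: set_lebesgue_integral_def)
  moreover have "(\<Sum>k. f k t) = indicator {0..} t *\<^sub>R (exp (- z * of_real t) * superposition n R t)" for t
  proof (cases "t \<ge> 0")
    case True
    have "summable (\<lambda>k. (1 / 2) ^ k * packet (n k) (R k) t)"
      by (rule summable_comparison_test'[OF summable_half, of 0]) (use norm_packet_term_le n True in auto)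
    then show ?thesis
      using True by (simp add: f_def superposition_def suminf_mult)
  qed (simp add: f_def)
  ultimately show ?thesis
    unfolding laplace_transform_def set_lebesgue_integral_def superposition_transform_def
    by (simp add: sums_iff)
qed

lemma Omega_Re_gt: "z \<in> Omega \<alpha> \<Longrightarrow> \<alpha> \<ge> 0 \<Longrightarrow> Re z > -1"
proof -
  assume z: "z \<in> Omega \<alpha>" and "\<alpha> \<ge> 0"
  then have "1 / (1 + \<bar>Im z\<bar>) powr \<alpha> \<le> 1"
    using ge_one_powr_ge_zero[of "1 + \<bar>Im z\<bar>" \<alpha>] by (simp add: field_simps)
  then have "- 1 \<le> - 1 / (1 + \<bar>Im z\<bar>) powr \<alpha>" by simp
  with z show ?thesis unfolding Omega_def by (blast intro: le_less_trans)
qed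

lemma open_Omega: "open (Omega \<alpha>)"
  unfolding Omega_def
  by (intro open_Collect_less continuous_intros) (auto simp: add_nonneg_eq_0_iff)

lemma packet_transform_holomorphic:
  assumes "\<alpha> \<ge> 0"
  shows "packet_transform n R holomorphic_on Omega \<alpha>"
proof -
  have "1 + z - \<i> * of_real R \<noteq> 0" if "z \<in> Omega \<alpha>" for z
    using Omega_Re_gt[OF that assms] by (auto simp: complex_eq_iff)
  then show ?thesis
    unfolding packet_transform_def by (intro holomorphic_intros) auto
qed

text \<open>
  A bound for the single transforms which is uniform in \<open>k\<close> and locally uniform in \<open>z\<close> makes the
  series of transforms converge locally uniformly, hence to a holomorphic function.
\<close>

lemma superposition_laplace_extension:
  assumes n: "\<And>k. n k > 0" and "\<alpha> \<ge> 0" "\<beta> \<ge> 0"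
    and bound: "\<And>k z. z \<in> Omega \<alpha> \<Longrightarrow> norm (packet_transform (n k) (R k) z) \<le> (1 + \<bar>Im z\<bar>) powr \<beta>"
  shows "is_laplace_extension (superposition n R) (Omega \<alpha>) (superposition_transform n R)"
proof -
  have "superposition_transform n R holomorphic_on Omega \<alpha>"
  proof (rule holomorphic_uniform_sequence[OF open_Omega])
    show "(\<lambda>z. \<Sum>k<N. (1 / 2) ^ k * packet_transform (n k) (R k) z) holomorphic_on Omega \<alpha>" for N
      by (intro holomorphic_intros packet_transform_holomorphic assms)
    fix x assume "x \<in> Omega \<alpha>"
    then obtain d where d: "d > 0" "cball x d \<subseteq> Omega \<alpha>"
      using open_Omega open_contains_cball by blast
    have "norm ((1 / 2) ^ k * packet_transform (n k) (R k) z) \<le> (1 / 2) ^ k * (1 + \<bar>Im x\<bar> + d) powr \<beta>"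
      if z: "z \<in> cball x d" for k z
    proof -
      have "\<bar>Im x - Im z\<bar> \<le> d"
        using z abs_Im_le_cmod[of "x - z"] by (simp add: dist_norm)
      then have "(1 + \<bar>Im z\<bar>) powr \<beta> \<le> (1 + \<bar>Im x\<bar> + d) powr \<beta>"
        using \<open>\<beta> \<ge> 0\<close> by (intro powr_mono2) auto
      with bound[of z k] z d have "norm (packet_transform (n k) (R k) z) \<le> (1 + \<bar>Im x\<bar> + d) powr \<beta>"
        by auto
      then show ?thesis
        by (auto simp: norm_mult norm_power norm_divide intro!: mult_left_mono)
    qed
    then have "uniform_limit (cball x d) (\<lambda>N z. \<Sum>k<N. (1 / 2) ^ k * packet_transform (n k) (R k) z)
        (superposition_transform n R) sequentially"
      unfolding superposition_transform_def
      by (intro Weierstrass_m_test[OF _ summable_mult2[OF summable_half]])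
    with d show "\<exists>d>0. cball x d \<subseteq> Omega \<alpha> \<and> uniform_limit (cball x d)
        (\<lambda>N z. \<Sum>k<N. (1 / 2) ^ k * packet_transform (n k) (R k) z) (superposition_transform n R) sequentially"
      by blast
  qed
  then have "superposition_transform n R analytic_on Omega \<alpha>"
    by (simp add: analytic_on_open open_Omega)
  moreover have "{z. Re z > 0} \<subseteq> Omega \<alpha>"
    unfolding Omega_def by (auto intro: le_less_trans[rotated])
  ultimately show ?thesis
    unfolding is_laplace_extension_def by (simp add: laplace_superposition n)
qed

text \<open>
  Each transform is rational and vanishes at infinity, and the weighted terms are dominated by
  \<open>(1/2)\<^sup>k\<close> on the region: the \<open>O\<close>-bound for the packets becomes an \<open>o\<close>-bound for the sum.
\<close>

lemma superposition_transform_little_o: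
  assumes "\<beta> \<ge> 0"
    and bound: "\<And>k z. z \<in> Omega \<alpha> \<Longrightarrow> norm (packet_transform (n k) (R k) z) \<le> (1 + \<bar>Im z\<bar>) powr \<beta>"
  shows "((\<lambda>z. superposition_transform n R z * of_real ((1 + \<bar>Im z\<bar>) powr (- \<beta>))) \<longlongrightarrow> 0)
      (inf at_infinity (principal (Omega \<alpha>)))"
proof -
  let ?w = "\<lambda>z. complex_of_real ((1 + \<bar>Im z\<bar>) powr (- \<beta>))"
  let ?F = "inf at_infinity (principal (Omega \<alpha>))"
  have in_Omega: "\<forall>\<^sub>F z in ?F. z \<in> Omega \<alpha>"
    by (simp add: eventually_inf_principal)
  have "((\<lambda>z. \<Sum>k. (1 / 2) ^ k * packet_transform (n k) (R k) z * ?w z) \<longlongrightarrow> 0) ?F"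
  proof (rule tendsto_suminf_0[OF _ _ summable_half])
    fix k
    have "filterlim (\<lambda>z. (1 - \<i> * of_real (R k)) + z) at_infinity at_infinity"
      by (rule tendsto_add_filterlim_at_infinity[OF tendsto_const filterlim_ident])
    then have "filterlim (\<lambda>z. ((1 - \<i> * of_real (R k)) + z) ^ Suc (n k)) at_infinity at_infinity"
      by (rule Limits.filterlim_power_at_infinity) simp
    then have "(packet_transform (n k) (R k) \<longlongrightarrow> 0) at_infinity"
      unfolding packet_transform_def
      by (intro tendsto_divide_0[OF tendsto_const]) (simp add: algebra_simps)
    then have "((\<lambda>z. (1 / 2) ^ k * packet_transform (n k) (R k) z) \<longlongrightarrow> 0) at_infinity"
      by (rule tendsto_mult_right_zero)
    then have "((\<lambda>z. norm ((1 / 2) ^ k * packet_transform (n k) (R k) z)) \<longlongrightarrow> 0) at_infinity"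
      by (rule tendsto_norm_zero)
    then have "((\<lambda>z. (1 / 2) ^ k * packet_transform (n k) (R k) z * ?w z) \<longlongrightarrow> 0) at_infinity"
    proof (rule Lim_null_comparison[rotated], intro always_eventually allI)
      fix z
      have "(1 + \<bar>Im z\<bar>) powr (- \<beta>) \<le> 1"
        using ge_one_powr_ge_zero[of "1 + \<bar>Im z\<bar>" \<beta>] \<open>\<beta> \<ge> 0\<close> by (simp add: powr_minus field_simps)
      then have "norm (?w z) \<le> 1" by simp
      then show "norm ((1 / 2) ^ k * packet_transform (n k) (R k) z * ?w z)
          \<le> norm ((1 / 2) ^ k * packet_transform (n k) (R k) z)"
        unfolding norm_mult[of _ "?w z"] by (intro mult_left_le) auto
    qed
    then show "((\<lambda>z. (1 / 2) ^ k * packet_transform (n k) (R k) z * ?w z) \<longlongrightarrow> 0) ?F"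
      by (rule tendsto_mono[rotated]) simp
  next
    show "\<forall>\<^sub>F z in ?F. \<forall>k. norm ((1 / 2) ^ k * packet_transform (n k) (R k) z * ?w z) \<le> (1 / 2) ^ k"
      using in_Omega
    proof eventually_elim
      case (elim z)
      show ?case
      proof
        fix k
        have "norm (packet_transform (n k) (R k) z) * (1 + \<bar>Im z\<bar>) powr (- \<beta>)
            \<le> (1 + \<bar>Im z\<bar>) powr \<beta> * (1 + \<bar>Im z\<bar>) powr (- \<beta>)"
          by (intro mult_right_mono bound elim) auto
        also have "\<dots> = 1" by (simp add: powr_minus field_simps)
        finally have "(1 / 2) ^ k * (norm (packet_transform (n k) (R k) z) * (1 + \<bar>Im z\<bar>) powr (- \<beta>)) \<le> (1 / 2) ^ k * 1"
          by (intro mult_left_mono) auto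
        then show "norm ((1 / 2) ^ k * packet_transform (n k) (R k) z * ?w z) \<le> (1 / 2) ^ k"
          by (simp add: norm_mult norm_power norm_divide mult.assoc)
      qed
    qed
  qed
  moreover have "\<forall>\<^sub>F z in ?F. (\<Sum>k. (1 / 2) ^ k * packet_transform (n k) (R k) z * ?w z)
      = superposition_transform n R z * ?w z"
    using in_Omega
  proof eventually_elim
    case (elim z)
    have "norm ((1 / 2) ^ k * packet_transform (n k) (R k) z) \<le> (1 / 2) ^ k * (1 + \<bar>Im z\<bar>) powr \<beta>" for k
      using bound[OF elim, of k] by (auto simp: norm_mult norm_power norm_divide intro!: mult_left_mono)
    then have "summable (\<lambda>k. (1 / 2) ^ k * packet_transform (n k) (R k) z)"
      by (intro summable_comparison_test'[OF summable_mult2[OF summable_half], of 0])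
    then show ?case
      unfolding superposition_transform_def by (rule suminf_mult2[symmetric])
  qed
  ultimately show ?thesis by (rule Lim_transform_eventually)
qed

section \<open>The oscillation produced by one packet\<close>

text \<open>
  Over half a period the function \<open>sin (R (s - a))\<close> is nonnegative with integral \<open>2 / R\<close>. Testing
  \<open>f\<close> against the imaginary part of \<open>cis (- R a) f\<close> bounds the integral below by
  \<open>c (1 / R - \<pi> / (8 R))\<close>, the subtracted term being the contribution of the error.
\<close>

lemma norm_integral_half_period_ge:
  fixes f :: "real \<Rightarrow> complex"
  assumes "R > 0" "c \<ge> 0" and b: "b = a + pi / R"
    and cont: "continuous_on {a..b} f"
    and h: "\<And>s. s \<in> {a..b} \<Longrightarrow> h s \<ge> 1 / 2"
    and close: "\<And>s. s \<in> {a..b} \<Longrightarrow> norm (f s - of_real c * (cis (R * s) * of_real (h s))) \<le> c / 8"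
  shows "c / (2 * R) \<le> norm (integral {a..b} f)"
proof -
  have ab: "a \<le> b" using assms by simp
  have f: "f integrable_on {a..b}"
    by (rule integrable_continuous_interval[OF cont])
  define l where "l z = Im (cis (- (R * a)) * z)" for z
  have l: "bounded_linear l"
    unfolding l_def by (intro bounded_linear_compose[OF bounded_linear_Im] bounded_linear_mult_right)
  have l_le: "\<bar>l z\<bar> \<le> norm z" for z
    using abs_Im_le_cmod[of "cis (- (R * a)) * z"] by (simp add: l_def norm_mult)
  define G where "G s = c * (- cos (R * (s - a)) / (2 * R) - s / 8)" for s
  have "((\<lambda>s. c * (sin (R * (s - a)) / 2 - 1 / 8)) has_integral G b - G a) {a..b}"
    unfolding G_def using \<open>R > 0\<close> ab
    by (intro fundamental_theorem_of_calculus)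
       (auto intro!: derivative_eq_intros simp: algebra_simps simp flip: has_real_derivative_iff_has_vector_derivative)
  moreover have "((l \<circ> f) has_integral l (integral {a..b} f)) {a..b}"
    by (intro has_integral_linear[OF _ l] integrable_integral f)
  moreover have "c * (sin (R * (s - a)) / 2 - 1 / 8) \<le> (l \<circ> f) s" if s: "s \<in> {a..b}" for s
  proof -
    have "R * (s - a) \<le> R * (pi / R)"
      using s b \<open>R > 0\<close> by (intro mult_left_mono) auto
    then have "sin (R * (s - a)) \<ge> 0"
      using s \<open>R > 0\<close> by (intro sin_ge_zero) auto
    then have "c * (sin (R * (s - a)) * (1 / 2)) \<le> c * (sin (R * (s - a)) * h s)"
      using h[OF s] \<open>c \<ge> 0\<close> by (intro mult_left_mono) auto
    also have "\<dots> = l (of_real c * (cis (R * s) * of_real (h s)))"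
    proof -
      have "cis (R * (s - a)) = cis (- (R * a)) * cis (R * s)"
        by (simp add: cis_mult algebra_simps)
      then have "cis (- (R * a)) * (of_real c * (cis (R * s) * of_real (h s)))
          = of_real (c * h s) * cis (R * (s - a))"
        by simp
      then have "l (of_real c * (cis (R * s) * of_real (h s))) = Im (of_real (c * h s) * cis (R * (s - a)))"
        unfolding l_def by (rule arg_cong)
      then show ?thesis by simp
    qed
    also have "\<dots> = l (f s) - l (f s - of_real c * (cis (R * s) * of_real (h s)))"
      by (simp add: linear_diff[OF bounded_linear.linear[OF l]])
    also have "\<dots> \<le> l (f s) + c / 8"
      using l_le[of "f s - of_real c * (cis (R * s) * of_real (h s))"] close[OF s] by linarith
    finally show ?thesis by (simp add: algebra_simps)
  qed
  ultimately have "G b - G a \<le> l (integral {a..b} f)"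
    by (rule has_integral_le)
  also have "\<dots> \<le> norm (integral {a..b} f)"
    using l_le[of "integral {a..b} f"] by linarith
  finally have "G b - G a \<le> norm (integral {a..b} f)" .
  moreover have "G b - G a = c / R * (1 - pi / 8)"
    using \<open>R > 0\<close> by (simp add: G_def b field_simps)
  moreover have "c / R * (1 / 2) \<le> c / R * (1 - pi / 8)"
    using assms pi_less_4 by (intro mult_left_mono) auto
  ultimately show ?thesis by simp
qed

section \<open>Sparse peaks do not interfere\<close>

lemma gap_iterate:
  fixes n :: "nat \<Rightarrow> nat"
  assumes gap: "\<And>k. n (Suc k) \<ge> 8 * (n k + 4)" and "i < j"
  shows "n j \<ge> 8 * (n i + 4)"
  using \<open>i < j\<close>
proof (induction rule: strict_inc_induct)
  case (base i)
  then show ?case using gap by simp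
next
  case (step i)
  then show ?case using gap[of i] by simp
qed

lemma gap_linear_growth:
  fixes n :: "nat \<Rightarrow> nat"
  assumes gap: "\<And>k. n (Suc k) \<ge> 8 * (n k + 4)" 
  shows "n k \<ge> 32 * k"
proof (induction k)
  case (Suc k)
  then show ?case using gap[of k] by simp
qed simp

lemma gap_positive:
  fixes n :: "nat \<Rightarrow> nat"
  assumes gap: "\<And>k. n (Suc k) \<ge> 8 * (n k + 4)" and "n 0 > 0"
  shows "n k > 0"
  using gap[of "k - 1"] \<open>n 0 > 0\<close> by (cases k) auto

text \<open>
  A packet with an earlier peak has decayed, since \<open>2\<^bsup>n j\<^esup> e\<^bsup>-s/2\<^esup>\<close> is tiny once \<open>s\<close> is a large multiple
  of \<open>n j\<close>, and a packet with a later peak has not started yet. The exponent \<open>k + 4\<close> makes the sum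
  of all the others at most one eighth of the weight of the \<open>k\<close>-th packet.
\<close>

lemma bump_other_le:
  fixes n :: "nat \<Rightarrow> nat"
  assumes gap: "\<And>k. n (Suc k) \<ge> 8 * (n k + 4)" and "n 0 > 0" "j \<noteq> k"
    and s: "real (n k) \<le> s" "s \<le> n k + 1 / 2"
  shows "bump (n j) s \<le> (1 / 2) ^ (k + 4)"
proof -
  note pos = gap_positive[of n, OF gap \<open>n 0 > 0\<close>]
  consider "j < k" | "k < j" using \<open>j \<noteq> k\<close> by linarith
  then show ?thesis
  proof cases
    case 1
    define m where "m = n j + k + 4"
    have "2 * m \<le> n k"
      using gap_iterate[of n, OF gap 1] gap_linear_growth[of n k, OF gap] unfolding m_def by presburger
    then have "real (2 * m) \<le> n k" by (simp only: of_nat_le_iff)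
    then have "real m \<le> s / 2" using s by simp
    then have "exp (- s / 2) \<le> exp (- real m)" by simp
    also have "\<dots> = exp (- 1) ^ m"
      using exp_of_nat_mult[of m "- 1 :: real"] by simp
    also have "\<dots> \<le> (1 / 2) ^ m"
      using exp_ge_add_one_self[of 1] by (intro power_mono) (auto simp: exp_minus field_simps)
    finally have "2 ^ n j * exp (- s / 2) \<le> 2 ^ n j * (1 / 2) ^ m"
      by (intro mult_left_mono) auto
    also have "\<dots> = (1 / 2) ^ (k + 4)"
      by (simp add: m_def power_add power_divide)
    finally show ?thesis
      using bump_le_exp_decay[OF pos[of j], of s] s by linarith
  next
    case 2
    have "real (8 * (n k + 4)) \<le> n j"
      using gap_iterate[of n, OF gap 2] by (simp only: of_nat_le_iff)
    then have "8 * s \<le> n j" using s by simp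
    then have "bump (n j) s \<le> (1 / 2) ^ n j"
      using s pos by (intro bump_le_before_peak) auto
    also have "k + 4 \<le> n j"
      using 2 gap_linear_growth[of n j, OF gap] by linarith
    then have "(1 / 2 :: real) ^ n j \<le> (1 / 2) ^ (k + 4)"
      by (intro power_decreasing) auto
    finally show ?thesis .
  qed
qed

lemma superposition_near_packet:
  fixes n :: "nat \<Rightarrow> nat"
  assumes gap: "\<And>k. n (Suc k) \<ge> 8 * (n k + 4)" and "n 0 > 0"
    and s: "real (n k) \<le> s" "s \<le> n k + 1 / 2"
  shows "norm (superposition n R s - (1 / 2) ^ k * packet (n k) (R k) s) \<le> (1 / 2) ^ k / 8"
proof -
  note pos = gap_positive[of n, OF gap \<open>n 0 > 0\<close>]
  have "s \<ge> 0" using s by linarith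
  let ?f = "\<lambda>j. (1 / 2) ^ j * packet (n j) (R j) s"
  have "summable ?f"
    by (rule summable_comparison_test'[OF summable_half, of 0])
       (use norm_packet_term_le pos \<open>s \<ge> 0\<close> in auto)
  then have "(\<lambda>j. ?f j - (if j = k then ?f j else 0)) sums (superposition n R s - ?f k)"
    unfolding superposition_def by (intro sums_diff summable_sums sums_single)
  then have "superposition n R s - ?f k = (\<Sum>j. ?f j - (if j = k then ?f j else 0))"
    by (simp add: sums_iff)
  also have "norm \<dots> \<le> (\<Sum>j. (1 / 2) ^ j * (1 / 2) ^ (k + 4))"
  proof (rule norm_suminf_le[OF _ summable_mult2[OF summable_half]])
    fix j
    show "norm (?f j - (if j = k then ?f j else 0)) \<le> (1 / 2) ^ j * (1 / 2) ^ (k + 4)"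
      using bump_other_le[of n, OF gap \<open>n 0 > 0\<close> _ s, of j] \<open>s \<ge> 0\<close>
      by (auto simp: norm_mult norm_power norm_divide norm_packet intro!: mult_left_mono simp del: power_add)
  qed
  also have "\<dots> = 2 * (1 / 2) ^ (k + 4)"
    using suminf_mult2[OF summable_half, of "(1 / 2) ^ (k + 4)"] suminf_geometric[of "1 / 2 :: real"] by simp
  also have "\<dots> = (1 / 2) ^ k / 8"
    by (simp add: power_add power_divide)
  finally show ?thesis .
qed

lemma superposition_integral_ge:
  fixes n :: "nat \<Rightarrow> nat"
  assumes gap: "\<And>k. n (Suc k) \<ge> 8 * (n k + 4)" and "n 0 > 0" and "R k \<ge> 8"
  shows "(1 / 2) ^ k / (2 * R k) \<le> norm (integral {n k..n k + pi / R k} (superposition n R))"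
proof (rule norm_integral_half_period_ge[where h = "bump (n k)"])
  note pos = gap_positive[of n, OF gap \<open>n 0 > 0\<close>]
  have "pi / R k \<le> 1 / 2"
    using pi_less_4 \<open>R k \<ge> 8\<close> by (simp add: field_simps)
  then have near: "real (n k) \<le> s \<and> s \<le> n k + 1 / 2" if "s \<in> {n k..n k + pi / R k}" for s
    using that unfolding atLeastAtMost_iff by linarith
  show "1 / 2 \<le> bump (n k) s" if "s \<in> {n k..n k + pi / R k}" for s
    using near[OF that] pos by (intro bump_ge_near_peak) auto
  show "norm (superposition n R s - of_real ((1 / 2) ^ k) * (cis (R k * s) * of_real (bump (n k) s)))
      \<le> (1 / 2) ^ k / 8" if "s \<in> {n k..n k + pi / R k}" for s
    using superposition_near_packet[of n k s R, OF gap \<open>n 0 > 0\<close>] near[OF that]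
    by (simp add: packet_def power_divide)
  have "continuous_on {0..} (superposition n R)"
    using superposition_in_C0[of n R] pos by (simp add: C0_halfline_def)
  then show "continuous_on {n k..n k + pi / R k} (superposition n R)"
    by (rule continuous_on_subset) auto
qed (use \<open>R k \<ge> 8\<close> in auto)

section \<open>Lower bounds for the defect\<close>

text \<open>
  The integral over \<open>[a, b]\<close> is the difference of the defects at \<open>a\<close> and \<open>b\<close>, so they cannot both be
  small, whatever the value \<open>w\<close> from which the primitive is subtracted.
\<close>

lemma large_defect_at_endpoint:
  fixes f :: "real \<Rightarrow> complex"
  assumes cont: "continuous_on {0..} f" and "0 \<le> a" "a \<le> b"
    and d: "2 * d \<le> norm (integral {a..b} f)"
  obtains t where "t \<in> {a, b}" "d \<le> norm (w - (LBINT s:{0..t}. f s))"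
proof -
  have c: "continuous_on {0..t} f" for t
    using cont by (rule continuous_on_subset) auto
  have L: "(LBINT s:{0..t}. f s) = integral {0..t} f" for t
    by (intro set_borel_integral_eq_integral borel_integrable_atLeastAtMost' c)
  have "integral {0..a} f + integral {a..b} f = integral {0..b} f"
    using assms by (intro Henstock_Kurzweil_Integration.integral_combine integrable_continuous_interval c)
  then have "integral {a..b} f = (w - integral {0..a} f) - (w - integral {0..b} f)"
    by (simp add: algebra_simps)
  then have "2 * d \<le> norm (w - integral {0..a} f) + norm (w - integral {0..b} f)"
    using d norm_triangle_ineq4[of "w - integral {0..a} f" "w - integral {0..b} f"] by simp
  then have "d \<le> norm (w - integral {0..a} f) \<or> d \<le> norm (w - integral {0..b} f)"
    by linarith
  then show ?thesis using that unfolding L by blast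
qed

lemma Limsup_at_top_pos:
  fixes g :: "real \<Rightarrow> real"
  assumes "c > 0" and freq: "\<And>T. \<exists>t\<ge>T. c \<le> g t"
  shows "Limsup at_top (\<lambda>t. ereal (g t)) > 0"
proof -
  have "ereal c \<le> Limsup at_top (\<lambda>t. ereal (g t))"
  proof (rule Limsup_greatest)
    fix P :: "real \<Rightarrow> bool" assume "eventually P at_top"
    then obtain T where T: "\<And>t. t \<ge> T \<Longrightarrow> P t"
      by (auto simp: eventually_at_top_linorder)
    from freq[of T] obtain t where "t \<ge> T" "c \<le> g t" by blast
    then show "ereal c \<le> (SUP t\<in>Collect P. ereal (g t))"
      using T by (intro SUP_upper2[of t]) auto
  qed
  moreover have "0 < ereal c" using \<open>c > 0\<close> by simp
  ultimately show ?thesis by (rule less_le_trans[rotated])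
qed

text \<open>
  All the requirements on the peak of the \<open>k\<close>-th packet hold for all large integers, so the peaks
  can be chosen one after the other.
\<close>

lemma sparse_sequence:
  fixes \<gamma> :: "real \<Rightarrow> real"
  assumes "\<gamma> \<in> C0_halfline" and "eventually P sequentially"
  obtains n :: "nat \<Rightarrow> nat" where "n 0 > 1" "\<And>k. n (Suc k) \<ge> 8 * (n k + 4)" "\<And>k. P (n k)"
    "\<And>k t. t \<ge> real (n k) \<Longrightarrow> \<gamma> t \<le> ((1 / 2) ^ k) powr \<alpha>"
proof -
  define Q where "Q k m \<longleftrightarrow> m > 1 \<and> P m \<and> (\<forall>t\<ge>real m. \<gamma> t \<le> ((1 / 2) ^ k) powr \<alpha>)" for k m
  have "\<forall>\<^sub>F m in sequentially. Q k m" for k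
  proof -
    have "(\<gamma> \<longlongrightarrow> 0) at_top" using assms by (simp add: C0_halfline_def)
    then have "\<forall>\<^sub>F t in at_top. \<gamma> t < ((1 / 2) ^ k) powr \<alpha>"
      by (rule order_tendstoD) simp
    then obtain T where T: "\<And>t. t \<ge> T \<Longrightarrow> \<gamma> t \<le> ((1 / 2) ^ k) powr \<alpha>"
      by (auto simp: eventually_at_top_linorder intro: less_imp_le)
    have "\<forall>\<^sub>F m in sequentially. real m \<ge> T"
      using filterlim_real_sequentially by (rule filterlim_at_top[THEN iffD1, rule_format])
    with assms(2) eventually_gt_at_top[of 1] show ?thesis
      unfolding Q_def by eventually_elim (auto intro!: T)
  qed
  then have ex: "\<exists>m. Q k m \<and> m \<ge> l" for k l
    using eventually_happens[OF eventually_conj[OF _ eventually_ge_at_top[of l]]] by auto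
  have "\<exists>n. \<forall>k. Q k (n k) \<and> n (Suc k) \<ge> 8 * (n k + 4)"
    by (rule dependent_nat_choice) (use ex in auto)
  then show ?thesis using that unfolding Q_def by auto
qed

section \<open>Optimality of the logarithmic rate\<close>

theorem theorem3p8:
  fixes \<alpha> \<beta> :: real and \<gamma> :: "real \<Rightarrow> real"
  assumes "\<alpha> > 0" and "\<beta> > \<alpha> / 2"
    and "\<gamma> \<in> C0_halfline" and "\<And>t. t \<ge> 0 \<Longrightarrow> \<gamma> t > 0"
  shows "\<exists>f \<in> C0_halfline. \<exists>F.
    is_laplace_extension f (Omega \<alpha>) F \<and>
    ((\<lambda>z. F z * of_real ((1 + \<bar>Im z\<bar>) powr (- \<beta>))) \<longlongrightarrow> 0)
      (inf at_infinity (principal (Omega \<alpha>))) \<and>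
    Limsup at_top (\<lambda>t::real. ereal (t / (\<gamma> t * ln t) *
      cmod (F 0 - (LBINT s:{0..t}. f s)) powr \<alpha>)) > 0"
proof -
  obtain A where A: "A > 0" and ev: "\<forall>\<^sub>F n in sequentially. freq A \<alpha> n \<ge> 8 \<and>
      (\<forall>z\<in>Omega \<alpha>. norm (packet_transform n (freq A \<alpha> n) z) \<le> (1 + \<bar>Im z\<bar>) powr \<beta>)"
    using eventually_packet_transform_bound[OF assms(1,2)] by blast
  obtain n :: "nat \<Rightarrow> nat" where n0: "n 0 > 1" and gap: "\<And>k. n (Suc k) \<ge> 8 * (n k + 4)"
    and P: "\<And>k. freq A \<alpha> (n k) \<ge> 8 \<and>
      (\<forall>z\<in>Omega \<alpha>. norm (packet_transform (n k) (freq A \<alpha> (n k)) z) \<le> (1 + \<bar>Im z\<bar>) powr \<beta>)"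
    and \<gamma>: "\<And>k t. t \<ge> real (n k) \<Longrightarrow> \<gamma> t \<le> ((1 / 2) ^ k) powr \<alpha>"
    using sparse_sequence[OF assms(3) ev] by blast
  define R where "R k = freq A \<alpha> (n k)" for k
  have n_gt: "n k > 1" for k
    using gap[of "k - 1"] n0 by (cases k) auto
  then have pos: "n k > 0" for k
    using less_trans zero_less_one by blast
  have R: "R k \<ge> 8" for k using P by (simp add: R_def)
  have bound: "norm (packet_transform (n k) (R k) z) \<le> (1 + \<bar>Im z\<bar>) powr \<beta>" if "z \<in> Omega \<alpha>" for k z
    using P that by (simp add: R_def)
  define f where "f = superposition n R"
  define F where "F = superposition_transform n R"
  define c where "c = (1 / 4) powr \<alpha> / (2 * A)"
  have C0: "f \<in> C0_halfline"
    unfolding f_def by (rule superposition_in_C0[OF pos])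
  have "Limsup at_top (\<lambda>t::real. ereal (t / (\<gamma> t * ln t) *
      cmod (F 0 - (LBINT s:{0..t}. f s)) powr \<alpha>)) > 0"
  proof (rule Limsup_at_top_pos)
    show "c > 0" using A by (simp add: c_def)
    fix T :: real
    obtain k :: nat where "real k \<ge> T" using real_arch_simple by blast
    moreover have "n k \<ge> k" using gap_linear_growth[of n k, OF gap] by linarith
    ultimately have nT: "real (n k) \<ge> T" by linarith
    let ?e = "((1 / 2) ^ k :: real)" and ?E = "\<lambda>t. cmod (F 0 - (LBINT s:{0..t}. f s))"
    have "2 * (?e / (4 * R k)) \<le> norm (integral {n k..n k + pi / R k} f)"
      using superposition_integral_ge[of n R k, OF gap pos R] by (simp add: f_def)
    then obtain t where t: "t \<in> {real (n k), n k + pi / R k}" and E: "?e / (4 * R k) \<le> ?E t"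
      using C0 R[of k] large_defect_at_endpoint[of f "n k" "n k + pi / R k" "?e / (4 * R k)" "F 0"]
      by (auto simp: C0_halfline_def)
    have t_ge: "t \<ge> n k" using t R[of k] by auto
    have t_gt: "t > 1" using t_ge n_gt[of k] by linarith
    have "pi / R k \<le> 1"
      using pi_less_4 R[of k] by (simp add: field_simps)
    then have "t \<le> n k + 1" using t by auto
    also have "\<dots> \<le> real (n k) * 2" using n_gt[of k] by simp
    also have "\<dots> \<le> real (n k) * n k" using n_gt[of k] by (intro mult_left_mono) auto
    finally have "ln t \<le> ln (real (n k) * n k)"
      using t_gt by (intro ln_mono) auto
    also have "\<dots> = 2 * ln (n k)"
      using pos[of k] by (simp add: ln_mult)
    finally have ln_t: "ln t \<le> 2 * ln (n k)" .
    have ln_n: "ln (n k) > 0" using n_gt[of k] by simp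
    have R_pow: "R k powr \<alpha> = A * n k / ln (n k)"
      using A ln_n \<open>\<alpha> > 0\<close> by (simp add: R_def freq_def powr_powr)
    have \<gamma>_pos: "\<gamma> t > 0" using assms(4) t_gt by simp
    \<comment> \<open>The weight \<open>?e\<close> cancels: its \<open>\<alpha>\<close>-th power dominates \<open>\<gamma> t\<close> in the denominator and is a factor
      of the \<open>\<alpha>\<close>-th power of the defect.\<close>
    have "c = n k / (?e powr \<alpha> * (2 * ln (n k))) * (?e / (4 * R k)) powr \<alpha>"
      using ln_n A pos[of k] R[of k] by (simp add: c_def powr_divide powr_mult R_pow field_simps)
    also have "\<dots> \<le> t / (\<gamma> t * ln t) * ?E t powr \<alpha>"
    proof (rule mult_mono)
      show "n k / (?e powr \<alpha> * (2 * ln (n k))) \<le> t / (\<gamma> t * ln t)"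
        using t_ge t_gt \<gamma>_pos \<gamma>[OF t_ge] ln_t by (intro frac_le mult_mono mult_pos_pos) auto
      show "(?e / (4 * R k)) powr \<alpha> \<le> ?E t powr \<alpha>"
        using E R[of k] \<open>\<alpha> > 0\<close> by (intro powr_mono2) auto
    qed (use t_gt \<gamma>_pos in auto)
    finally show "\<exists>t\<ge>T. c \<le> t / (\<gamma> t * ln t) * ?E t powr \<alpha>"
      using t_ge nT by (intro exI[of _ t]) auto
  qed
  moreover have "is_laplace_extension f (Omega \<alpha>) F"
    unfolding f_def F_def using assms by (intro superposition_laplace_extension[OF pos _ _ bound]) auto
  moreover have "((\<lambda>z. F z * of_real ((1 + \<bar>Im z\<bar>) powr (- \<beta>))) \<longlongrightarrow> 0)
      (inf at_infinity (principal (Omega \<alpha>)))"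
    unfolding F_def using assms by (intro superposition_transform_little_o[OF _ bound]) auto
  ultimately show ?thesis using C0 by blast
qed

end
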